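(* Let $n\ge1$ be an integer, $0\leq\alpha<1$, $\lambda>0$, and let $g$ be analytic in $\mathbb{D}$. If $$|g(z)|<\frac{\delta(n+1)(n-\alpha)}{\alpha+(n+1)(n-\alpha)}\qquad(z\in\mathbb{D}),$$ where $\delta$ is the smallest positive root of $$\phi(r):=(1+n)\bigl(2\alpha n-\lambda(n+1)-n\bigr)r^2+n(1-\alpha+n)\bigl(2\lambda(n+1)+n+\alpha n^2\bigr)r-\lambda n^2(n+1-\alpha)^2,$$ then the function $$f(z)=z+z^{n+1}\int_0^1\int_0^1 g(rsz)\,r^{n-1-\alpha}s^{n}\,dr\,ds$$ belongs to $G_{\lambda,\alpha}$.
   Context: $\mathbb{D}=\{z\in\mathbb{C}:|z|<1\}$. $\mathcal{A}$ is the class of analytic functions $f$ on $\mathbb{D}$ with $f(0)=0$, $f'(0)=1$. For $0\le\alpha\le1$ and $\lambda>0$, $$G_{\lambda,\alpha}=\left\{f\in\mathcal{A}:\left|\frac{1-\alpha+\alpha zf''(z)/f'(z)}{zf'(z)/f(z)}-(1-\alpha)\right|<\lambda,\ z\in\mathbb{D}\right\},$$ where expressions such as $zf'(z)/f(z)$ are given their limiting values at $z=0$. *)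

theory Defs
  imports "HOL-Complex_Analysis.Complex_Analysis"
begin

definition class_A :: "(complex \<Rightarrow> complex) set" where
  "class_A = {f. f holomorphic_on ball 0 1 \<and> f 0 = 0 \<and> deriv f 0 = 1}"

text \<open>The function \<open>z f'(z) / f(z)\<close>, given its limiting value at the origin.\<close>

definition zf'_over_f :: "(complex \<Rightarrow> complex) \<Rightarrow> complex \<Rightarrow> complex" where
  "zf'_over_f f z =
     (if z = 0 then Lim (at 0) (\<lambda>w. w * deriv f w / f w) else z * deriv f z / f z)"

text \<open>The nonvanishing conditions say that the expression inside the modulus is meaningful on
  the whole disc; without them, HOL's convention \<open>x / 0 = 0\<close> would give it spurious values at
  zeros of \<open>f'\<close> and at zeros of \<open>f\<close> other than the origin.\<close>

definition class_G :: "real \<Rightarrow> real \<Rightarrow> (complex \<Rightarrow> complex) set" where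
  "class_G lam \<alpha> = {f \<in> class_A.
     (\<forall>z \<in> ball 0 1. deriv f z \<noteq> 0) \<and>
     (\<forall>z \<in> ball 0 1 - {0}. f z \<noteq> 0) \<and>
     (\<forall>z \<in> ball 0 1.
        cmod ((1 - of_real \<alpha> + of_real \<alpha> * (z * deriv (deriv f) z / deriv f z)) / zf'_over_f f z
               - (1 - of_real \<alpha>)) < lam)}"

definition phi :: "nat \<Rightarrow> real \<Rightarrow> real \<Rightarrow> real \<Rightarrow> real" where
  "phi n \<alpha> lam r =
     (1 + real n) * (2 * \<alpha> * real n - lam * (real n + 1) - real n) * r\<^sup>2
     + real n * (1 - \<alpha> + real n) * (2 * lam * (real n + 1) + real n + \<alpha> * (real n)\<^sup>2) * r
     - lam * (real n)\<^sup>2 * (real n + 1 - \<alpha>)\<^sup>2"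

end

theory Submission
  imports Defs
begin

text \<open>On power series, \<open>\<integral>\<^sub>0\<^sup>1 g (r z) r powr (a - 1) dr\<close> divides the \<open>k\<close>-th coefficient by \<open>k + a\<close>, so
  it is the holomorphic solution \<open>P\<close> of \<open>z P' + a P = g\<close>. With \<open>P\<close> and \<open>R\<close> the solutions for
  \<open>a = n - \<alpha>\<close> and \<open>a = n + 1\<close>, the partial fraction identity shows that the double integral is
  \<open>Q = (P - R) / (1 + \<alpha>)\<close>. Hence \<open>f / z = 1 + z\<^sup>n Q\<close>, \<open>f' = 1 + z\<^sup>n P\<close>,
  \<open>f' - f / z = z\<^sup>n (\<alpha> P + R) / (1 + \<alpha>)\<close> and \<open>z f'' = z\<^sup>n (g + \<alpha> P)\<close>, all of which are bounded by
  multiples of \<open>\<bar>z\<bar>\<^sup>n sup \<bar>g\<bar>\<close>. Writing the quantity in the definition of the class as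
  \<open>(1 - \<alpha>) (f / z - f') / f' + \<alpha> z f'' (f / z) / f'\<^sup>2\<close>, the triangle inequality bounds it by a quantity
  that is less than \<open>\<lambda>\<close> exactly when \<open>\<phi>\<close> is negative, and \<open>\<phi>\<close> is negative on \<open>(0, \<delta>)\<close>.\<close>

section \<open>The Euler equation on the disc: solution, integral formula and bound\<close>

lemma euler_ode_holomorphic_solution:
  fixes g :: "complex \<Rightarrow> complex" and a :: real
  assumes g: "g holomorphic_on ball 0 1" and a: "a > 0"
  obtains P where "P holomorphic_on ball 0 1"
    and "\<And>z. z \<in> ball 0 1 \<Longrightarrow> z * deriv P z + of_real a * P z = g z"
proof -
  define c where "c k = (deriv ^^ k) g 0 / fact k" for k
  define b where "b k = c k / of_real (real k + a)" for k
  have gs: "(\<lambda>k. c k * z ^ k) sums g z" if "norm z < 1" for z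
    using holomorphic_power_series[OF g, of z] that by (simp add: c_def)
  have bs: "summable (\<lambda>k. b k * z ^ k)" if "norm z < 1" for z
  proof (rule summable_comparison_test')
    \<comment> \<open>Absolute convergence at \<open>z\<close> comes from convergence at the radius
      \<open>(norm z + 1) / 2\<close>, which lies strictly between \<open>norm z\<close> and
      1.\<close>
    have "summable (\<lambda>k. norm (c k * of_real (norm z) ^ k))"
    proof (rule powser_insidea)
      show "summable (\<lambda>k. c k * of_real ((norm z + 1) / 2) ^ k)"
        using gs[of "of_real ((norm z + 1) / 2)"] that
        by (intro sums_summable[OF gs]) (simp add: norm_of_real del: of_real_divide of_real_add)
      show "norm (of_real (norm z) :: complex) < norm (of_real ((norm z + 1) / 2) :: complex)"
        using that by (simp add: norm_of_real del: of_real_divide of_real_add)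
    qed
    then show "summable (\<lambda>k. norm (c k * z ^ k) / a)"
      by (intro summable_divide) (simp add: norm_mult norm_power)
    show "norm (b k * z ^ k) \<le> norm (c k * z ^ k) / a" if "k \<ge> 0" for k
    proof -
      have "norm (b k) \<le> norm (c k) / a"
        using a by (auto simp: b_def norm_divide simp del: of_real_add intro!: divide_left_mono)
      then show ?thesis
        by (metis mult_right_mono norm_ge_zero norm_mult times_divide_eq_left)
    qed
  qed
  define P where "P z = (\<Sum>k. b k * z ^ k)" for z
  have DP: "(P has_field_derivative (\<Sum>k. diffs b k * z ^ k)) (at z)" if "norm z < 1" for z
    unfolding P_def using bs that by (rule termdiffs_strong')
  show ?thesis
  proof
    show "P holomorphic_on ball 0 1"
      by (rule holomorphic_onI) (meson DP field_differentiable_at_within field_differentiable_def mem_ball_0)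
    fix z :: complex assume z: "z \<in> ball 0 1"
    then have nz: "norm z < 1" by simp
    have "summable (\<lambda>k. diffs b k * z ^ k)"
      by (rule termdiff_converges[OF nz bs])
    \<comment> \<open>The exponent in \<open>diffs_equiv\<close> is \<open>k - 1\<close>. The factor
      \<open>z\<close> restores \<open>k\<close>, and at \<open>k = 0\<close>, where the subtraction
      truncates, the coefficient is 0.\<close>
    from sums_mult[OF diffs_equiv[OF this], of z]
    have "(\<lambda>k. of_nat k * b k * z ^ k) sums (z * deriv P z)"
      unfolding DERIV_imp_deriv[OF DP[OF nz]]
      by (rule sums_cong[THEN iffD1, rotated]) (case_tac k; simp add: mult_ac)
    moreover have "(\<lambda>k. of_real a * (b k * z ^ k)) sums (of_real a * P z)"
      unfolding P_def by (intro sums_mult summable_sums bs nz)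
    ultimately have "(\<lambda>k. of_nat k * b k * z ^ k + of_real a * (b k * z ^ k))
        sums (z * deriv P z + of_real a * P z)"
      by (rule sums_add)
    moreover have "of_nat k * b k * z ^ k + of_real a * (b k * z ^ k) = c k * z ^ k" for k
    proof -
      have "(of_nat k + of_real a :: complex) \<noteq> 0"
        using a by (metis add_nonneg_pos of_nat_0_le_iff of_real_add of_real_eq_0_iff of_real_of_nat_eq
            order_less_irrefl)
      then have "(of_nat k + of_real a) * b k = c k" by (simp add: b_def)
      then show ?thesis by (metis distrib_right mult.assoc)
    qed
    ultimately show "z * deriv P z + of_real a * P z = g z"
      using gs[OF nz] sums_unique2 by simp
  qed
qed

text \<open>For \<open>0 < r < 1\<close> the derivative of \<open>r powr a * P (r z)\<close> in
  \<open>r\<close> is \<open>r powr (a - 1)\<close> times the left side of the equation at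
  \<open>r z\<close>. The boundary term at 0 vanishes because \<open>a > 0\<close>.\<close>

lemma euler_ode_has_integral:
  fixes g P :: "complex \<Rightarrow> complex" and a :: real
  assumes P: "P holomorphic_on ball 0 1" and a: "a > 0"
    and ode: "\<And>z. z \<in> ball 0 1 \<Longrightarrow> z * deriv P z + of_real a * P z = g z"
    and z: "z \<in> ball 0 1"
  shows "((\<lambda>r. g (of_real r * z) * of_real (r powr (a - 1))) has_integral P z) {0..1}"
proof -
  have in_ball: "of_real r * z \<in> ball 0 1" if "r \<in> {0..1}" for r :: real
    using that z by (simp add: norm_mult) (meson mult_left_le_one_le norm_ge_zero order_le_less_trans)
  have "((\<lambda>r. g (of_real r * z) * of_real (r powr (a - 1))) has_integral
      of_real (1 powr a) * P (of_real 1 * z) - of_real (0 powr a) * P (of_real 0 * z)) {0..1}"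
  \<comment> \<open>For \<open>a < 1\<close> the factor \<open>r powr (a - 1)\<close> is unbounded
    near 0, so only continuity of the primitive is asked for at the endpoints.\<close>
  proof (rule fundamental_theorem_of_calculus_interior)
    have "continuous_on {0..1} (\<lambda>r. P (of_real r * z))"
      by (rule continuous_on_compose2[OF holomorphic_on_imp_continuous_on[OF P]])
        (use in_ball in \<open>auto intro!: continuous_intros\<close>)
    moreover have "continuous_on {0..1} (\<lambda>r::real. r powr a)"
      using a by (intro continuous_on_powr') (auto intro!: continuous_intros)
    ultimately show "continuous_on {0..1} (\<lambda>r. of_real (r powr a) * P (of_real r * z))"
      by (intro continuous_on_mult continuous_on_of_real)
    fix r :: real assume r: "r \<in> {0<..<1}"
    have "(P has_field_derivative deriv P (of_real r * z)) (at (of_real r * z))"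
      using P in_ball[of r] r by (intro holomorphic_derivI[OF P]) auto
    moreover have "((\<lambda>r. of_real r * z) has_vector_derivative z) (at r)"
      by (auto intro!: derivative_eq_intros)
    ultimately have "((\<lambda>r. P (of_real r * z)) has_vector_derivative z * deriv P (of_real r * z)) (at r)"
      using field_vector_diff_chain_at by (fastforce simp: o_def)
    moreover have "((\<lambda>r. of_real (r powr a) :: complex) has_vector_derivative
        of_real (a * r powr (a - 1))) (at r)"
      using r by (intro has_vector_derivative_of_real)
        (auto intro!: derivative_eq_intros simp: has_real_derivative_iff_has_vector_derivative[symmetric])
    ultimately have "((\<lambda>r. of_real (r powr a) * P (of_real r * z)) has_vector_derivative
        of_real (r powr a) * (z * deriv P (of_real r * z)) +
        of_real (a * r powr (a - 1)) * P (of_real r * z)) (at r)"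
      by (rule has_vector_derivative_mult[rotated])
    moreover have "of_real (r powr a) * (z * deriv P (of_real r * z)) +
        of_real (a * r powr (a - 1)) * P (of_real r * z) = g (of_real r * z) * of_real (r powr (a - 1))"
    proof -
      have "r powr a = r powr (a - 1) * r"
        using r by (simp add: powr_diff)
      moreover have "g (of_real r * z) =
          of_real r * z * deriv P (of_real r * z) + of_real a * P (of_real r * z)"
        using ode[OF in_ball, of r] r by simp
      ultimately show ?thesis by (simp add: algebra_simps)
    qed
    ultimately show "((\<lambda>r. of_real (r powr a) * P (of_real r * z)) has_vector_derivative
        g (of_real r * z) * of_real (r powr (a - 1))) (at r)"
      by simp
  qed simp
  with a show ?thesis by simp
qed

text \<open>In the integral formula, \<open>g\<close> is replaced by its bound; \<open>1 / a\<close>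
  is the integral of \<open>r powr (a - 1)\<close> over the unit interval.\<close>

lemma euler_ode_norm_bound:
  fixes g P :: "complex \<Rightarrow> complex" and a M :: real
  assumes P: "P holomorphic_on ball 0 1" and a: "a > 0"
    and ode: "\<And>z. z \<in> ball 0 1 \<Longrightarrow> z * deriv P z + of_real a * P z = g z"
    and M: "\<And>z. z \<in> ball 0 1 \<Longrightarrow> norm (g z) \<le> M"
    and z: "z \<in> ball 0 1"
  shows "norm (P z) \<le> M / a"
proof -
  have powr_int: "((\<lambda>r. M * r powr (a - 1)) has_integral M / a) {0..1::real}"
    using has_integral_mult_right[OF has_integral_powr_from_0[of "a - 1" 1], of M] a by simp
  have int: "((\<lambda>r. g (of_real r * z) * of_real (r powr (a - 1))) has_integral P z) {0..1}"
    using P a ode z by (rule euler_ode_has_integral)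
  have "norm (integral {0..1} (\<lambda>r. g (of_real r * z) * of_real (r powr (a - 1))))
      \<le> integral {0..1} (\<lambda>r. M * r powr (a - 1))"
  proof (rule integral_norm_bound_integral)
    fix r :: real assume "r \<in> {0..1}"
    then have "of_real r * z \<in> ball 0 1"
      using z by (simp add: norm_mult) (meson mult_left_le_one_le norm_ge_zero order_le_less_trans)
    then show "norm (g (of_real r * z) * of_real (r powr (a - 1))) \<le> M * r powr (a - 1)"
      using M by (simp add: norm_mult mult_right_mono)
  qed (use int powr_int in \<open>auto simp: integrable_on_def\<close>)
  then show ?thesis
    by (simp only: integral_unique[OF int] integral_unique[OF powr_int])
qed

section \<open>The pointwise estimate and the quadratic \<open>phi\<close>\<close>

lemma class_G_quotient_bound:
  fixes u p q :: complex and y m \<alpha> :: real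
  assumes u: "norm (u - 1) \<le> y" and p: "norm (p - 1) \<le> (m + 1) * y"
    and pu: "norm (p - u) \<le> m * y" and q: "norm q \<le> m * (m + 1) * y"
    and y: "(m + 1) * y < 1" and \<alpha>: "0 \<le> \<alpha>" "\<alpha> \<le> 1"
  shows "norm ((1 - of_real \<alpha> + of_real \<alpha> * (q / p)) / (p / u) - (1 - of_real \<alpha>))
    \<le> (1 - \<alpha>) * (m * y / (1 - (m + 1) * y))
      + \<alpha> * (m * (m + 1) * y * (1 + y) / (1 - (m + 1) * y)\<^sup>2)"
proof -
  \<comment> \<open>In the application \<open>u\<close>, \<open>p\<close>, \<open>q\<close> are
    \<open>f / z\<close>, \<open>f'\<close>, \<open>z f''\<close>, with \<open>m = n\<close>. The
    number \<open>d\<close> is a lower bound for \<open>norm p\<close>.\<close>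
  define d where "d = 1 - (m + 1) * y"
  have d: "d > 0" using y by (simp add: d_def)
  have "norm p \<ge> d"
    using p norm_triangle_ineq2[of 1 "1 - p"] by (simp add: d_def norm_minus_commute)
  then have p0: "p \<noteq> 0" and p2: "d\<^sup>2 \<le> (norm p)\<^sup>2"
    using d by (auto intro: power_mono)
  have "norm u \<le> 1 + y"
    using u norm_triangle_ineq[of 1 "u - 1"] by simp
  \<comment> \<open>The signs of \<open>m\<close> and \<open>y\<close> are left open; the
    nonnegative numerators needed for monotonicity are read off from the norm bounds.\<close>
  have "norm ((u - p) / p) \<le> m * y / d"
    using pu \<open>norm p \<ge> d\<close> d order_trans[OF norm_ge_zero pu]
    by (simp add: norm_divide norm_minus_commute frac_le)
  moreover have "norm (q * u / p\<^sup>2) \<le> m * (m + 1) * y * (1 + y) / d\<^sup>2"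
    unfolding norm_divide norm_mult norm_power
    using q \<open>norm u \<le> 1 + y\<close> p2 d order_trans[OF norm_ge_zero q]
      order_trans[OF norm_ge_zero \<open>norm u \<le> 1 + y\<close>]
    by (intro frac_le mult_mono) auto
  \<comment> \<open>Division by \<open>p / u\<close> is multiplication by \<open>u / p\<close>; this
    persists at \<open>u = 0\<close>, where \<open>x / 0 = 0\<close> makes both sides equal to
    \<open>-(1 - \<alpha>)\<close>.\<close>
  moreover have "(1 - of_real \<alpha> + of_real \<alpha> * (q / p)) / (p / u) - (1 - of_real \<alpha>)
      = of_real (1 - \<alpha>) * ((u - p) / p) + of_real \<alpha> * (q * u / p\<^sup>2)"
    using p0 by (simp add: field_simps power2_eq_square)
  moreover have "norm (of_real (1 - \<alpha>) * ((u - p) / p) + of_real \<alpha> * (q * u / p\<^sup>2))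
      \<le> (1 - \<alpha>) * norm ((u - p) / p) + \<alpha> * norm (q * u / p\<^sup>2)"
    using \<alpha> by (intro order_trans[OF norm_triangle_ineq]) (simp only: norm_mult norm_of_real abs_of_nonneg)
  ultimately show ?thesis
    unfolding d_def[symmetric] using \<alpha>
    by (smt (verit) mult_left_mono)
qed

text \<open>This explains the coefficients of \<open>phi\<close>: the bracket is the bound of
  \<open>class_G_quotient_bound\<close> at \<open>m = n\<close>, minus \<open>lam\<close>, after
  multiplication by \<open>(1 - (n + 1) y)^2\<close>.\<close>

lemma phi_rescaled:
  "phi n \<alpha> lam (real n * (real n + 1 - \<alpha>) * y)
    = (real n * (real n + 1 - \<alpha>))\<^sup>2 *
      ((1 - \<alpha>) * (real n * y) * (1 - (real n + 1) * y) + \<alpha> * (real n * (real n + 1) * y * (1 + y))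
        - lam * (1 - (real n + 1) * y)\<^sup>2)"
  unfolding phi_def by algebra

lemma quotient_bound_less_iff_phi_neg:
  assumes "n \<ge> 1" "\<alpha> < 1" "(real n + 1) * y < 1"
  shows "(1 - \<alpha>) * (real n * y / (1 - (real n + 1) * y))
      + \<alpha> * (real n * (real n + 1) * y * (1 + y) / (1 - (real n + 1) * y)\<^sup>2) < lam
    \<longleftrightarrow> phi n \<alpha> lam (real n * (real n + 1 - \<alpha>) * y) < 0"
proof -
  define d where "d = 1 - (real n + 1) * y"
  have d: "d > 0" using assms by (simp add: d_def)
  have "(1 - \<alpha>) * (real n * y / d) + \<alpha> * (real n * (real n + 1) * y * (1 + y) / d\<^sup>2)
      = ((1 - \<alpha>) * (real n * y) * d + \<alpha> * (real n * (real n + 1) * y * (1 + y))) / d\<^sup>2"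
    using d by (simp add: field_simps power2_eq_square)
  moreover have "(real n * (real n + 1 - \<alpha>))\<^sup>2 > 0"
    using assms by simp
  ultimately show ?thesis
    unfolding phi_rescaled d_def[symmetric] using d
    by (simp add: pos_divide_less_eq mult_less_0_iff)
qed

text \<open>Since \<open>phi\<close> is negative at 0, the intermediate value theorem puts a
  positive root at or below every \<open>r > 0\<close> where \<open>phi\<close> is nonnegative.
  Hence \<open>phi\<close> is negative below the least root, and one such \<open>r\<close> bounds
  that root from above.\<close>

lemma least_root_phi:
  assumes n: "n \<ge> 1" and \<alpha>: "0 \<le> \<alpha>" "\<alpha> < 1" and lam: "lam > 0"
    and \<delta>: "\<delta> = (LEAST r. r > 0 \<and> phi n \<alpha> lam r = 0)"
  shows "\<delta> > 0" and "\<delta> \<le> real n * (real n + 1 - \<alpha>) / (real n + 1)"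
    and "\<And>r. 0 < r \<Longrightarrow> r < \<delta> \<Longrightarrow> phi n \<alpha> lam r < 0"
proof -
  \<comment> \<open>On the reals \<open>LEAST\<close> needs an attained minimum. The root set is
    finite because the polynomial has a nonzero constant term.\<close>
  define p where "p = [:phi n \<alpha> lam 0,
    real n * (1 - \<alpha> + real n) * (2 * lam * (real n + 1) + real n + \<alpha> * (real n)\<^sup>2),
    (1 + real n) * (2 * \<alpha> * real n - lam * (real n + 1) - real n):]"
  have poly_p: "poly p r = phi n \<alpha> lam r" for r
    unfolding p_def phi_def by (simp add: power2_eq_square algebra_simps)
  have neg0: "phi n \<alpha> lam 0 < 0"
    using assms by (simp add: phi_def)
  then have "p \<noteq> 0" by (auto simp: p_def)
  then have fin: "finite {r. r > 0 \<and> phi n \<alpha> lam r = 0}"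
    using poly_roots_finite[of p] by (auto simp: poly_p intro: rev_finite_subset)
  \<comment> \<open>This is \<open>y = 1 / (n + 1)\<close> in \<open>phi_rescaled\<close>: both
    terms containing \<open>1 - (n + 1) y\<close> vanish and a nonnegative multiple of
    \<open>\<alpha>\<close> remains.\<close>
  define K where "K = real n * (real n + 1 - \<alpha>) / (real n + 1)"
  have K: "K > 0" using n \<alpha> by (simp add: K_def)
  have root: "\<exists>x>0. x \<le> r \<and> phi n \<alpha> lam x = 0" if r: "r > 0" "phi n \<alpha> lam r \<ge> 0" for r
  proof -
    have "continuous_on {0..r} (phi n \<alpha> lam)"
      unfolding phi_def by (intro continuous_intros)
    from IVT'[OF _ _ _ this, of 0] obtain x where "0 \<le> x" "x \<le> r" "phi n \<alpha> lam x = 0"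
      using neg0 r by (metis less_imp_le)
    moreover from this have "x \<noteq> 0" using neg0 by auto
    ultimately show ?thesis by (intro exI[of _ x]) simp
  qed
  have "phi n \<alpha> lam K \<ge> 0"
    using phi_rescaled[of n \<alpha> lam "1 / (real n + 1)"] n \<alpha> by (simp add: K_def)
  from root[OF K this] obtain x where x: "0 < x" "x \<le> K" "phi n \<alpha> lam x = 0" by blast
  then have \<delta>_Min: "\<delta> = Min {r. r > 0 \<and> phi n \<alpha> lam r = 0}"
    unfolding \<delta> by (intro Least_Min[OF fin]) blast
  have "\<delta> \<in> {r. r > 0 \<and> phi n \<alpha> lam r = 0}"
    unfolding \<delta>_Min using fin x by (intro Min_in) auto
  then show "\<delta> > 0" by simp
  have le: "\<delta> \<le> r" if "r > 0" "phi n \<alpha> lam r = 0" for r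
    unfolding \<delta>_Min using fin that by (intro Min_le) auto
  show "\<delta> \<le> real n * (real n + 1 - \<alpha>) / (real n + 1)"
    using le[OF x(1,3)] x(2) by (simp add: K_def)
  show "phi n \<alpha> lam r < 0" if "0 < r" "r < \<delta>" for r
    using root[of r] le that by force
qed

section \<open>Membership in the class from two nested Euler equations\<close>

lemma class_G_of_euler_odes:
  fixes n :: nat and \<alpha> lam x :: real and g P Q F :: "complex \<Rightarrow> complex"
  assumes n: "n \<ge> 1" and \<alpha>: "0 \<le> \<alpha>" "\<alpha> < 1"
    and P: "P holomorphic_on ball 0 1"
    and odeP: "\<And>z. z \<in> ball 0 1 \<Longrightarrow> z * deriv P z + of_real (real n - \<alpha>) * P z = g z"
    and Q: "Q holomorphic_on ball 0 1"
    and odeQ: "\<And>z. z \<in> ball 0 1 \<Longrightarrow> z * deriv Q z + of_real (real n + 1) * Q z = P z"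
    and bnd_g: "\<And>z. z \<in> ball 0 1 \<Longrightarrow> norm (g z) \<le> (real n + 1) * (real n - \<alpha>) * x"
    and bnd_PQ: "\<And>z. z \<in> ball 0 1 \<Longrightarrow> norm (P z - Q z) \<le> real n * x"
    and x: "(real n + 1) * x \<le> 1"
    and neg: "\<And>y. 0 < y \<Longrightarrow> y < x \<Longrightarrow> phi n \<alpha> lam (real n * (real n + 1 - \<alpha>) * y) < 0"
    and x0: "x > 0" and lam: "lam > 0"
    and F: "\<And>z. z \<in> ball 0 1 \<Longrightarrow> F z = z + z ^ (n + 1) * Q z"
  shows "F \<in> class_G lam \<alpha>"
proof -
  have na: "real n - \<alpha> > 0" using n \<alpha> by linarith
  \<comment> \<open>The scale \<open>x\<close> is chosen so that dividing the bound on
    \<open>g\<close> by \<open>n - \<alpha>\<close> and then by \<open>n + 1\<close> leaves exactly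
    \<open>x\<close> for \<open>Q\<close>.\<close>
  have bnd_P: "norm (P z) \<le> (real n + 1) * x" if "z \<in> ball 0 1" for z
    using euler_ode_norm_bound[OF P na odeP bnd_g that] na by simp
  have bnd_Q: "norm (Q z) \<le> x" if "z \<in> ball 0 1" for z
    using euler_ode_norm_bound[OF Q _ odeQ bnd_P that] by (simp add: add_pos_nonneg)
  have D1: "(F has_field_derivative 1 + z ^ n * P z) (at z)" if z: "z \<in> ball 0 1" for z
  proof -
    have "((\<lambda>z. z + z ^ (n + 1) * Q z) has_field_derivative
        1 + (of_nat (n + 1) * z ^ n * Q z + z ^ (n + 1) * deriv Q z)) (at z)"
      using DERIV_add[OF DERIV_ident DERIV_mult[OF DERIV_power[OF DERIV_ident, of "n + 1" z]
            holomorphic_derivI[OF Q open_ball z]]]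
      by (simp add: algebra_simps)
    moreover have "of_nat (n + 1) * z ^ n * Q z + z ^ (n + 1) * deriv Q z = z ^ n * P z"
      unfolding odeQ[OF z, symmetric] by (simp add: algebra_simps)
    ultimately have "((\<lambda>z. z + z ^ (n + 1) * Q z) has_field_derivative 1 + z ^ n * P z) (at z)"
      by simp
    then show ?thesis
      by (rule has_field_derivative_transform_within_open[where S = "ball 0 1"]) (use z F in auto)
  qed
  have dF: "deriv F z = 1 + z ^ n * P z" if "z \<in> ball 0 1" for z
    using D1[OF that] by (rule DERIV_imp_deriv)
  have ddF: "z * deriv (deriv F) z = z ^ n * (g z + of_real \<alpha> * P z)" if z: "z \<in> ball 0 1" for z
  proof -
    have "((\<lambda>z. 1 + z ^ n * P z) has_field_derivative
        of_nat n * z ^ (n - 1) * P z + z ^ n * deriv P z) (at z)"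
      using z by (auto intro!: derivative_eq_intros holomorphic_derivI[OF P])
    then have "(deriv F has_field_derivative
        of_nat n * z ^ (n - 1) * P z + z ^ n * deriv P z) (at z)"
      by (rule has_field_derivative_transform_within_open[where S = "ball 0 1"]) (use z dF in auto)
    then have "z * deriv (deriv F) z = z * (of_nat n * z ^ (n - 1) * P z + z ^ n * deriv P z)"
      by (simp add: DERIV_imp_deriv)
    also have "\<dots> = of_nat n * z ^ n * P z + z ^ n * (z * deriv P z)"
      using n by (cases n) (auto simp: algebra_simps)
    also have "\<dots> = z ^ n * (g z + of_real \<alpha> * P z)"
      unfolding odeP[OF z, symmetric] by (simp add: algebra_simps)
    finally show ?thesis .
  qed
  have n0: "n \<noteq> 0" using n by simp
  \<comment> \<open>The origin is excluded because \<open>F 0 / 0 = 0\<close> would violate the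
    first bound.\<close>
  have bounds:
    "norm (F z / z - 1) \<le> x * norm z ^ n" (is ?B1)
    "norm (deriv F z - 1) \<le> (real n + 1) * (x * norm z ^ n)" (is ?B2)
    "norm (deriv F z - F z / z) \<le> real n * (x * norm z ^ n)" (is ?B3)
    "norm (z * deriv (deriv F) z) \<le> real n * (real n + 1) * (x * norm z ^ n)" (is ?B4)
    "(real n + 1) * (x * norm z ^ n) < 1" (is ?B5) "x * norm z ^ n < x" (is ?B6)
    if z: "z \<in> ball 0 1" "z \<noteq> 0" for z
  proof -
    have Fz: "F z / z = 1 + z ^ n * Q z" using z F by (simp add: field_simps)
    show ?B1
      using mult_right_mono[OF bnd_Q[OF z(1)], of "norm z ^ n"] by (simp add: Fz norm_mult norm_power mult.commute)
    show ?B2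
      using mult_right_mono[OF bnd_P[OF z(1)], of "norm z ^ n"]
      by (simp add: dF[OF z(1)] norm_mult norm_power mult_ac)
    \<comment> \<open>The triangle inequality with \<open>bnd_P\<close> and \<open>bnd_Q\<close>
      would give only the factor \<open>n + 2\<close>; \<open>bnd_PQ\<close> supplies
      \<open>n\<close>.\<close>
    have "deriv F z - F z / z = (P z - Q z) * z ^ n"
      by (simp add: Fz dF[OF z(1)] algebra_simps)
    then show ?B3
      using mult_right_mono[OF bnd_PQ[OF z(1)], of "norm z ^ n"]
      by (simp add: norm_mult norm_power mult_ac)
    have "norm (g z + of_real \<alpha> * P z) \<le> (real n + 1) * (real n - \<alpha>) * x + \<alpha> * ((real n + 1) * x)"
      using \<alpha> bnd_g[OF z(1)] bnd_P[OF z(1)]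
      by (intro order_trans[OF norm_triangle_ineq] add_mono) (auto simp: norm_mult mult_left_mono)
    also have "\<dots> = real n * (real n + 1) * x" by algebra
    finally have "norm (g z + of_real \<alpha> * P z) * norm z ^ n \<le> real n * (real n + 1) * x * norm z ^ n"
      by (rule mult_right_mono) simp
    then show ?B4
      by (simp add: ddF[OF z(1)] norm_mult norm_power mult_ac)
    \<comment> \<open>Strictness comes from \<open>norm z < 1\<close> and \<open>n >= 1\<close>. It
      matters because \<open>(n + 1) * x = 1\<close> is allowed and \<open>neg\<close> speaks only
      of \<open>y < x\<close>.\<close>
    show ?B6
      using z x0 n by (simp add: power_less_one_iff)
    then show ?B5
      using x by (smt (verit) mult_left_mono mult_strict_left_mono of_nat_0_le_iff)
  qed
  have dF_nz: "deriv F z \<noteq> 0" if z: "z \<in> ball 0 1" for z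
  proof (cases "z = 0")
    case True
    then show ?thesis using n0 by (simp add: dF power_0_left)
  next
    case False
    then show ?thesis using bounds(2,5)[OF z] by auto
  qed
  have F_nz: "F z \<noteq> 0" if z: "z \<in> ball 0 1" "z \<noteq> 0" for z
  proof
    \<comment> \<open>Then \<open>F z / z = 0\<close>, so the first bound would give
      \<open>1 <= x * norm z ^ n < x <= 1\<close>.\<close>
    assume "F z = 0"
    moreover have "x \<le> (real n + 1) * x" using x0 by (simp add: algebra_simps)
    ultimately show False using bounds(1,6)[OF z] x by simp
  qed
  \<comment> \<open>Cancelling \<open>w\<close> from numerator and denominator gives a quotient
    continuous at 0, which determines the limiting value in \<open>zf'_over_f\<close>.\<close>
  have "((\<lambda>w. (1 + w ^ n * P w) / (1 + w ^ n * Q w)) \<longlongrightarrow>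
      (1 + 0 ^ n * P 0) / (1 + 0 ^ n * Q 0)) (at 0)"
    using n0 holomorphic_on_imp_continuous_on[OF P] holomorphic_on_imp_continuous_on[OF Q]
    by (intro tendsto_intros) (auto simp: continuous_on_eq_continuous_at isCont_def power_0_left)
  moreover have "\<forall>\<^sub>F w in at 0. (1 + w ^ n * P w) / (1 + w ^ n * Q w) = w * deriv F w / F w"
  proof -
    have "(1 + w ^ n * P w) / (1 + w ^ n * Q w) = w * deriv F w / F w"
      if "w \<in> ball 0 1" "w \<noteq> 0" for w
    proof -
      have "F w = w * (1 + w ^ n * Q w)" using that by (simp add: F algebra_simps)
      then show ?thesis using that by (simp add: dF)
    qed
    then show ?thesis
      by (auto simp: eventually_at dist_norm intro!: exI[of _ 1])
  qed
  ultimately have "((\<lambda>w. w * deriv F w / F w) \<longlongrightarrow> 1) (at 0)"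
    using n0 by (auto simp: power_0_left intro: Lim_transform_eventually)
  then have lim: "zf'_over_f F 0 = 1"
    by (simp add: zf'_over_f_def tendsto_Lim)
  have "norm ((1 - of_real \<alpha> + of_real \<alpha> * (z * deriv (deriv F) z / deriv F z)) / zf'_over_f F z
      - (1 - of_real \<alpha>)) < lam" if z: "z \<in> ball 0 1" for z
  proof (cases "z = 0")
    case True
    then show ?thesis using lam by (simp add: lim)
  next
    case False
    have "zf'_over_f F z = deriv F z / (F z / z)"
      using False by (simp add: zf'_over_f_def)
    then have "norm ((1 - of_real \<alpha> + of_real \<alpha> * (z * deriv (deriv F) z / deriv F z)) / zf'_over_f F z
        - (1 - of_real \<alpha>)) \<le> (1 - \<alpha>) * (real n * (x * norm z ^ n) / (1 - (real n + 1) * (x * norm z ^ n)))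
      + \<alpha> * (real n * (real n + 1) * (x * norm z ^ n) * (1 + x * norm z ^ n)
        / (1 - (real n + 1) * (x * norm z ^ n))\<^sup>2)"
      using class_G_quotient_bound[OF bounds(1-5)[OF z False]] \<alpha> by simp
    also have "\<dots> < lam"
      using quotient_bound_less_iff_phi_neg[OF n \<alpha>(2) bounds(5)[OF z False]]
        neg[OF _ bounds(6)[OF z False]] x0 False by simp
    finally show ?thesis .
  qed
  moreover have "F holomorphic_on ball 0 1"
    using D1 holomorphic_on_open[of "ball 0 1" F] by blast
  ultimately show ?thesis
    using dF_nz F_nz n0 by (auto simp: class_G_def class_A_def dF F power_0_left)
qed

section \<open>Application to the double integral\<close>

theorem corollary2p5:
  fixes n :: nat and \<alpha> lam \<delta> :: real and g :: "complex \<Rightarrow> complex"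
  assumes "n \<ge> 1"
    and "0 \<le> \<alpha>" and "\<alpha> < 1"
    and "lam > 0"
    and "g holomorphic_on ball 0 1"
    and "\<delta> = (LEAST r. r > 0 \<and> phi n \<alpha> lam r = 0)"
    and "\<And>z. z \<in> ball 0 1 \<Longrightarrow>
           cmod (g z) < \<delta> * (real n + 1) * (real n - \<alpha>) / (\<alpha> + (real n + 1) * (real n - \<alpha>))"
  shows "(\<lambda>z. z + z ^ (n + 1) *
            integral {0..1} (\<lambda>s::real. integral {0..1} (\<lambda>r::real.
              g (of_real r * of_real s * z) * of_real (r powr (real n - 1 - \<alpha>)) * of_real s ^ n)))
         \<in> class_G lam \<alpha>"
proof -
  note \<delta> = least_root_phi[OF assms(1-4,6)]
  have na: "real n - \<alpha> > 0" and n1: "real n + 1 > 0" using assms(1,3) by linarith+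
  obtain P where P: "P holomorphic_on ball 0 1"
    and odeP: "\<And>z. z \<in> ball 0 1 \<Longrightarrow> z * deriv P z + of_real (real n - \<alpha>) * P z = g z"
    using euler_ode_holomorphic_solution[OF assms(5) na] by blast
  obtain R where R: "R holomorphic_on ball 0 1"
    and odeR: "\<And>z. z \<in> ball 0 1 \<Longrightarrow> z * deriv R z + of_real (real n + 1) * R z = g z"
    using euler_ode_holomorphic_solution[OF assms(5) n1] by blast
  \<comment> \<open>The two Euler parameters differ by \<open>1 + \<alpha>\<close>. Writing
    \<open>Q\<close> through \<open>R\<close>, instead of solving for it from \<open>P\<close>,
    gives the formula for \<open>P - Q\<close> behind \<open>bnd_PQ\<close>.\<close>
  define Q where "Q z = (P z - R z) / of_real (1 + \<alpha>)" for z
  have \<alpha>1: "(1 + of_real \<alpha> :: complex) \<noteq> 0"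
    using assms(2) by (metis add_pos_nonneg of_real_1 of_real_add of_real_eq_0_iff order_less_irrefl zero_less_one)
  have Q: "Q holomorphic_on ball 0 1"
    unfolding Q_def using \<alpha>1 by (intro holomorphic_intros P R) simp
  have odeQ: "z * deriv Q z + of_real (real n + 1) * Q z = P z" if z: "z \<in> ball 0 1" for z
  proof -
    have "(Q has_field_derivative (deriv P z - deriv R z) / of_real (1 + \<alpha>)) (at z)"
      unfolding Q_def using z
      by (intro DERIV_cdivide DERIV_diff holomorphic_derivI[OF P] holomorphic_derivI[OF R]) auto
    then have "deriv Q z = (deriv P z - deriv R z) / of_real (1 + \<alpha>)"
      by (rule DERIV_imp_deriv)
    \<comment> \<open>The left sides of both equations are split off; each equals
      \<open>g z\<close>, so they cancel and only \<open>P z\<close> survives.\<close>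
    then have "z * deriv Q z + of_real (real n + 1) * Q z
      = ((z * deriv P z + of_real (real n - \<alpha>) * P z) - (z * deriv R z + of_real (real n + 1) * R z)
          + of_real (1 + \<alpha>) * P z) / of_real (1 + \<alpha>)"
      unfolding Q_def by (simp add: algebra_simps flip: add_divide_distrib diff_divide_distrib)
    then show ?thesis using \<alpha>1 by (simp only: odeP odeR z) simp
  qed
  \<comment> \<open>\<open>N\<close> equals the denominator
    \<open>\<alpha> + (n + 1) (n - \<alpha>)\<close> in the hypothesis on \<open>g\<close> and is
    also the scaling factor in \<open>phi_rescaled\<close>.\<close>
  define N where "N = real n * (real n + 1 - \<alpha>)"
  define x where "x = \<delta> / N"
  have N: "N > 0" using assms(1,3) by (simp add: N_def)
  have \<delta>x: "\<delta> = N * x" using N by (simp add: x_def)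
  have x0: "x > 0" using \<delta>(1) N by (simp add: x_def)
  have bnd_g: "norm (g z) \<le> (real n + 1) * (real n - \<alpha>) * x" if "z \<in> ball 0 1" for z
  proof -
    have "\<alpha> + (real n + 1) * (real n - \<alpha>) = N" by (simp add: N_def algebra_simps)
    then show ?thesis using assms(7)[OF that] by (simp add: x_def mult_ac)
  qed
  have bnd_PQ: "norm (P z - Q z) \<le> real n * x" if z: "z \<in> ball 0 1" for z
  proof -
    have "norm (P z) \<le> (real n + 1) * x"
      using euler_ode_norm_bound[OF P na odeP bnd_g z] na by simp
    moreover have "norm (R z) \<le> (real n - \<alpha>) * x"
      using euler_ode_norm_bound[OF R n1 odeR bnd_g z] n1 by simp
    ultimately have "norm (of_real \<alpha> * P z + R z) \<le> \<alpha> * ((real n + 1) * x) + (real n - \<alpha>) * x"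
      using assms(2) by (intro order_trans[OF norm_triangle_ineq] add_mono)
        (auto simp: norm_mult mult_left_mono)
    also have "\<dots> = real n * x * (1 + \<alpha>)" by algebra
    finally have "norm (of_real \<alpha> * P z + R z) / (1 + \<alpha>) \<le> real n * x"
      using assms(2) by (simp add: pos_divide_le_eq)
    moreover have "P z - Q z = (of_real \<alpha> * P z + R z) / of_real (1 + \<alpha>)"
      using \<alpha>1 by (simp add: Q_def field_simps)
    ultimately show ?thesis using assms(2) by (simp add: norm_divide del: of_real_add)
  qed
  show ?thesis
  proof (rule class_G_of_euler_odes[OF assms(1-3) P odeP Q odeQ bnd_g bnd_PQ _ _ x0 assms(4)])
    show "(real n + 1) * x \<le> 1"
      using \<delta>(2)[folded N_def] N n1 by (simp add: x_def field_simps)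
    show "phi n \<alpha> lam (real n * (real n + 1 - \<alpha>) * y) < 0" if "0 < y" "y < x" for y
      using \<delta>(3)[of "N * y"] that N unfolding N_def[symmetric] \<delta>x by simp
    have exponent: "real n - 1 - \<alpha> = real n - \<alpha> - 1" by simp
    fix z :: complex assume z: "z \<in> ball 0 1"
    \<comment> \<open>The inner integral is the formula for \<open>P\<close> at \<open>s z\<close>,
      with \<open>s ^ n\<close> constant in \<open>r\<close>; the outer one is then the formula for
      \<open>Q\<close> with parameter \<open>n + 1\<close>.\<close>
    have inner: "integral {0..1} (\<lambda>r::real.
          g (of_real r * of_real s * z) * of_real (r powr (real n - 1 - \<alpha>)) * of_real s ^ n)
        = P (of_real s * z) * of_real (s powr (real n + 1 - 1))" if s: "s \<in> {0..1}" for s :: real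
    proof -
      have "of_real s * z \<in> ball 0 1"
        using s z by (simp add: norm_mult) (meson mult_left_le_one_le norm_ge_zero order_le_less_trans)
      from has_integral_mult_left[OF euler_ode_has_integral[OF P na odeP this], of "of_real s ^ n"]
      have "((\<lambda>r. g (of_real r * of_real s * z) * of_real (r powr (real n - 1 - \<alpha>)) * of_real s ^ n)
          has_integral P (of_real s * z) * of_real s ^ n) {0..1}"
        by (simp only: mult.assoc exponent)
      \<comment> \<open>At \<open>s = 0\<close> this relies on \<open>n >= 1\<close>, since
        \<open>0 powr 0 = 0\<close> whereas \<open>0 ^ 0 = 1\<close>.\<close>
      moreover have "of_real s ^ n = (of_real (s powr (real n + 1 - 1)) :: complex)"
        using s assms(1) by (simp add: powr_realpow')
      ultimately show ?thesis by (simp only: integral_unique)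
    qed
    have "integral {0..1} (\<lambda>s::real. integral {0..1} (\<lambda>r::real.
          g (of_real r * of_real s * z) * of_real (r powr (real n - 1 - \<alpha>)) * of_real s ^ n))
        = integral {0..1} (\<lambda>s. P (of_real s * z) * of_real (s powr (real n + 1 - 1)))"
      by (rule integral_cong) (rule inner)
    also have "\<dots> = Q z"
      by (rule integral_unique[OF euler_ode_has_integral[OF Q n1 odeQ z]])
    finally show "z + z ^ (n + 1) * integral {0..1} (\<lambda>s::real. integral {0..1} (\<lambda>r::real.
          g (of_real r * of_real s * z) * of_real (r powr (real n - 1 - \<alpha>)) * of_real s ^ n))
        = z + z ^ (n + 1) * Q z" by simp
  qed
qed

end
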